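(* The walk dimension of the 2-dimensional comb $\mathbf C_2$ is equal to $2$.
   Context: The 2-dimensional comb $\mathbf C_2$ is the graph with vertex set $\mathbb Z^2$ obtained from the usual square lattice by removing all horizontal edges off the $x$-axis: $(x,y)$ is adjacent to $(x,y\pm1)$ for all $x,y\in\mathbb Z$, and $(x,0)$ is adjacent to $(x\pm1,0)$ for all $x\in\mathbb Z$. The simple random walk $\{S_i\}_{i\ge0}$, started at $S_0=(0,0)$, moves at each step to a uniformly chosen neighbour of the current vertex. Let $\Vert(x,y)\Vert_1=|x|+|y|$ (the distance from the origin in the graph), let $B_n$ be the set of vertices $(x,y)$ with $\Vert (x,y)\Vert_1\le n$, and let $T_n=\min\{i:S_i\notin B_n\}$. Definition: if $\mathbb E[T_n]$ is of order $n^\alpha$ as $n\to\infty$ (i.e. $\mathbb E[T_n]/n^\alpha$ is bounded above and below by positive constants for large $n$), then $\alpha$ is called the walk dimension of the graph. *)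

theory Defs
  imports "HOL-Probability.Probability"
begin

text \<open>
  The transition probabilities are conditioned on the whole trajectory up to time \<open>n\<close>, so the
  Markov property is part of the definition. All degrees are meant to be finite and positive
  (\<^const>\<open>pmf_of_set\<close> is only meaningful for finite nonempty sets).
\<close>

locale simple_random_walk = prob_space M
  for M :: "'w measure" +
  fixes adj :: "'v \<Rightarrow> 'v \<Rightarrow> bool"
    and start :: 'v
    and S :: "nat \<Rightarrow> 'w \<Rightarrow> 'v"
  assumes measurable_walk: "\<And>n. S n \<in> measurable M (count_space UNIV)"
    and walk_start: "AE \<omega> in M. S 0 \<omega> = start"
    and walk_step: "\<And>n s v.
      \<P>(\<omega> in M. \<forall>i\<le>n. S i \<omega> = s i) > 0 \<Longrightarrow>
      \<P>(\<omega> in M. S (Suc n) \<omega> = v \<bar> \<forall>i\<le>n. S i \<omega> = s i) = pmf (pmf_of_set {w. adj (s n) w}) v"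

text \<open>The exit time is \<open>\<infinity>\<close> (the infimum of the empty set) if the walk never leaves \<open>B\<close>.\<close>

definition exit_time :: "(nat \<Rightarrow> 'w \<Rightarrow> 'v) \<Rightarrow> 'v set \<Rightarrow> 'w \<Rightarrow> enat" where
  "exit_time S B \<omega> = Inf {enat i | i. S i \<omega> \<notin> B}"

definition mean_exit_time :: "'w measure \<Rightarrow> (nat \<Rightarrow> 'w \<Rightarrow> 'v) \<Rightarrow> 'v set \<Rightarrow> ennreal" where
  "mean_exit_time M S B = (\<integral>\<^sup>+\<omega>. ennreal_of_enat (exit_time S B \<omega>) \<partial>M)"

definition has_walk_dimension ::
  "'w measure \<Rightarrow> (nat \<Rightarrow> 'w \<Rightarrow> 'v) \<Rightarrow> (nat \<Rightarrow> 'v set) \<Rightarrow> real \<Rightarrow> bool" where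
  "has_walk_dimension M S B \<alpha> \<longleftrightarrow>
    (\<exists>c C. 0 < c \<and> 0 < C \<and>
      (\<forall>\<^sub>F n in sequentially.
        ennreal (c * real n powr \<alpha>) \<le> mean_exit_time M S (B n) \<and>
        mean_exit_time M S (B n) \<le> ennreal (C * real n powr \<alpha>)))"

definition comb_adj :: "int \<times> int \<Rightarrow> int \<times> int \<Rightarrow> bool" where
  "comb_adj = (\<lambda>(x, y) (x', y'). (x' = x \<and> \<bar>y' - y\<bar> = 1) \<or> (y = 0 \<and> y' = 0 \<and> \<bar>x' - x\<bar> = 1))"

definition comb_ball :: "nat \<Rightarrow> (int \<times> int) set" where
  "comb_ball n = {(x, y). \<bar>x\<bar> + \<bar>y\<bar> \<le> int n}"

text \<open>
  The simple random walk on the comb exists: it can be driven by an i.i.d. sequence of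
  uniform choices in \<open>{0, 1, 2, 3}\<close>.
\<close>

definition comb_move :: "int \<times> int \<Rightarrow> nat \<Rightarrow> int \<times> int" where
  "comb_move = (\<lambda>(x, y) k.
    if y = 0 then (if k = 0 then (x, 1) else if k = 1 then (x, -1)
                   else if k = 2 then (x + 1, 0) else (x - 1, 0))
    else if k < 2 then (x, y + 1) else (x, y - 1))"

primrec comb_path :: "int \<times> int \<Rightarrow> nat \<Rightarrow> nat stream \<Rightarrow> int \<times> int" where
  "comb_path v 0 \<omega> = v"
| "comb_path v (Suc n) \<omega> = comb_path (comb_move v (shd \<omega>)) n (stl \<omega>)"

lemma comb_neighbours:
  "{w. comb_adj (x, y) w} =
    (if y = 0 then {(x, 1), (x, -1), (x + 1, 0), (x - 1, 0)} else {(x, y + 1), (x, y - 1)})"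
  by (auto simp: comb_adj_def)

lemma pmf_comb_move:
  "pmf (map_pmf (comb_move v) (pmf_of_set {..<4})) w = pmf (pmf_of_set {w. comb_adj v w}) w"
proof -
  obtain x y where v: "v = (x, y)" by (cases v)
  have four: "{..<4::nat} = {0, 1, 2, 3}" by auto
  have "pmf (map_pmf (comb_move v) (pmf_of_set {..<4})) w = card ({..<4} \<inter> comb_move v -` {w}) / 4"
    by (subst pmf_map, subst measure_pmf_of_set) (auto simp: four)
  also have "{..<4::nat} \<inter> comb_move v -` {w} = {k \<in> {0, 1, 2, 3}. comb_move v k = w}"
    by (auto simp: four)
  also have "\<dots> = (if comb_move v 0 = w then {0} else {}) \<union> (if comb_move v 1 = w then {1} else {})
      \<union> (if comb_move v 2 = w then {2} else {}) \<union> (if comb_move v 3 = w then {3} else {})"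
    by auto (metis gr0I)
  also have "card \<dots> / 4 = pmf (pmf_of_set {w. comb_adj v w}) w"
    unfolding v comb_neighbours
    by (subst pmf_of_set) (auto simp: comb_move_def indicator_def card_insert_if)
  finally show ?thesis .
qed

lemma measurable_comb_path [measurable]:
  "comb_path v n \<in> measurable (stream_space (measure_pmf (pmf_of_set {..<4}))) (count_space UNIV)"
proof (induction n arbitrary: v)
  case 0
  have "comb_path v 0 = (\<lambda>_. v)" by (simp add: fun_eq_iff)
  then show ?case by simp
next
  case (Suc n)
  have [measurable]: "shd \<in> stream_space (measure_pmf (pmf_of_set {..<4})) \<rightarrow>\<^sub>M count_space UNIV"
    by (rule measurable_compose[OF measurable_shd]) simp
  have "(\<lambda>\<omega>. comb_path (comb_move v (shd \<omega>)) n (stl \<omega>))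
      \<in> measurable (stream_space (measure_pmf (pmf_of_set {..<4}))) (count_space UNIV)"
    by (rule measurable_compose_countable[where g = shd])
      (auto intro!: measurable_compose[OF measurable_stl Suc])
  then show ?case by simp
qed

lemma emeasure_comb_path:
  fixes s :: "nat \<Rightarrow> int \<times> int"
  defines "N \<equiv> stream_space (measure_pmf (pmf_of_set {..<4}))"
  shows "emeasure N {\<omega> \<in> space N. \<forall>i\<le>n. comb_path v i \<omega> = s i} =
    (if s 0 = v then \<Prod>i<n. ennreal (pmf (pmf_of_set {w. comb_adj (s i) w}) (s (Suc i))) else 0)"
proof (induction n arbitrary: v s)
  case 0
  interpret N: prob_space N
    unfolding N_def by (rule prob_space.prob_space_stream_space[OF prob_space_measure_pmf])
  show ?case by (auto simp: N.emeasure_space_1)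
next
  case (Suc n)
  note [measurable] = measurable_comb_path[folded N_def]
  let ?p = "pmf_of_set {..<4::nat}"
  let ?P = "\<Prod>i<n. ennreal (pmf (pmf_of_set {w. comb_adj (s (Suc i)) w}) (s (Suc (Suc i))))"
  have all_Suc: "(\<forall>i\<le>Suc n. Q i) \<longleftrightarrow> Q 0 \<and> (\<forall>i\<le>n. Q (Suc i))" for Q
    by (metis Suc_le_mono less_eq_nat.simps(1) not0_implies_Suc)
  have "emeasure N {\<omega> \<in> space N. \<forall>i\<le>Suc n. comb_path v i \<omega> = s i} =
      (\<integral>\<^sup>+k. emeasure N {\<omega> \<in> space N. k ## \<omega> \<in> {\<omega> \<in> space N. \<forall>i\<le>Suc n. comb_path v i \<omega> = s i}}
        \<partial>measure_pmf ?p)"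
    unfolding N_def
    by (rule prob_space.emeasure_stream_space[OF prob_space_measure_pmf]) (simp add: N_def[symmetric])
  also have "\<dots> = (\<integral>\<^sup>+k. (if s 0 = v then ?P else 0) * indicator {s (Suc 0)} (comb_move v k)
        \<partial>measure_pmf ?p)"
  proof (rule nn_integral_cong)
    fix k
    have "{\<omega> \<in> space N. k ## \<omega> \<in> {\<omega> \<in> space N. \<forall>i\<le>Suc n. comb_path v i \<omega> = s i}} =
        (if s 0 = v then {\<omega> \<in> space N. \<forall>i\<le>n. comb_path (comb_move v k) i \<omega> = s (Suc i)} else {})"
      unfolding all_Suc by (auto simp: N_def space_stream_space)
    then show "emeasure N {\<omega> \<in> space N. k ## \<omega> \<in> {\<omega> \<in> space N. \<forall>i\<le>Suc n. comb_path v i \<omega> = s i}} =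
        (if s 0 = v then ?P else 0) * indicator {s (Suc 0)} (comb_move v k)"
      using Suc.IH[of "comb_move v k" "\<lambda>i. s (Suc i)"] by (auto simp: indicator_def)
  qed
  also have "\<dots> = (if s 0 = v then ?P else 0) *
      (\<integral>\<^sup>+w. indicator {s (Suc 0)} w \<partial>measure_pmf (map_pmf (comb_move v) ?p))"
    by (simp add: nn_integral_cmult nn_integral_map_pmf del: nn_integral_indicator)
  also have "\<dots> = (if s 0 = v then ?P else 0) *
      ennreal (pmf (pmf_of_set {w. comb_adj v w}) (s (Suc 0)))"
    by (subst nn_integral_indicator) (simp_all only: emeasure_pmf_single pmf_comb_move, simp_all)
  also have "\<dots> = (if s 0 = v
      then \<Prod>i<Suc n. ennreal (pmf (pmf_of_set {w. comb_adj (s i) w}) (s (Suc i))) else 0)"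
    by (subst prod.lessThan_Suc_shift) (auto simp: mult.commute)
  finally show ?case .
qed

lemma simple_random_walk_comb_exists:
  "simple_random_walk (stream_space (measure_pmf (pmf_of_set {..<4}))) comb_adj (0, 0) (comb_path (0, 0))"
proof -
  let ?N = "stream_space (measure_pmf (pmf_of_set {..<4::nat}))"
  interpret N: prob_space ?N
    by (rule prob_space.prob_space_stream_space[OF prob_space_measure_pmf])
  have path: "\<P>(\<omega> in ?N. \<forall>i\<le>n. comb_path (0, 0) i \<omega> = s i) =
      (if s 0 = (0, 0) then \<Prod>i<n. pmf (pmf_of_set {w. comb_adj (s i) w}) (s (Suc i)) else 0)" for n s
    using emeasure_comb_path[of n "(0, 0)" s]
    by (simp add: N.emeasure_eq_measure prod_ennreal prod_nonneg split: if_splits)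
  show ?thesis
  proof
    fix n v and s :: "nat \<Rightarrow> int \<times> int"
    assume pos: "\<P>(\<omega> in ?N. \<forall>i\<le>n. comb_path (0, 0) i \<omega> = s i) > 0"
    let ?s = "s(Suc n := v)"
    have "(comb_path (0, 0) (Suc n) \<omega> = v \<and> (\<forall>i\<le>n. comb_path (0, 0) i \<omega> = s i)) \<longleftrightarrow>
        (\<forall>i\<le>Suc n. comb_path (0, 0) i \<omega> = ?s i)" for \<omega>
      by (auto simp: le_Suc_eq simp del: comb_path.simps)
    then have "\<P>(\<omega> in ?N. comb_path (0, 0) (Suc n) \<omega> = v \<and> (\<forall>i\<le>n. comb_path (0, 0) i \<omega> = s i)) =
        \<P>(\<omega> in ?N. \<forall>i\<le>Suc n. comb_path (0, 0) i \<omega> = ?s i)"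
      by presburger
    also have "\<dots> = \<P>(\<omega> in ?N. \<forall>i\<le>n. comb_path (0, 0) i \<omega> = s i) *
        pmf (pmf_of_set {w. comb_adj (s n) w}) v"
      unfolding path by simp
    finally show "\<P>(\<omega> in ?N. comb_path (0, 0) (Suc n) \<omega> = v \<bar> \<forall>i\<le>n. comb_path (0, 0) i \<omega> = s i) =
        pmf (pmf_of_set {w. comb_adj (s n) w}) v"
      unfolding cond_prob_def using pos by (simp del: comb_path.simps)
  qed (simp_all add: measurable_comb_path del: comb_path.simps(2))
qed

end

theory Submission
  imports Defs
begin

text \<open>
  The mean exit time from the ball of radius \<open>n\<close> is squeezed between two explicit potentials. If
  \<open>g \<ge> 0\<close> drops by at least \<open>1\<close> on average in each step taken inside \<open>B\<close>, the walk cannot stay in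
  \<open>B\<close> for more than \<open>g start\<close> steps on average (\<open>mean_exit_time_le\<close>); if \<open>h \<le> 0\<close> outside \<open>B\<close> and
  \<open>h\<close> drops by at most \<open>1\<close>, it stays for at least \<open>h start\<close> steps (\<open>mean_exit_time_ge\<close>).

  Put \<open>N = n + 1\<close>. The tooth above \<open>x\<close> has its exit point at height \<open>m = N - \<bar>x\<bar>\<close>. A function
  that depends on \<open>\<bar>y\<bar>\<close>, drops by exactly \<open>1\<close> on the tooth, vanishes at its tip, and has the value
  \<open>a\<^sub>x\<close> on the spine must be \<open>(m - \<bar>y\<bar>) (a\<^sub>x / m + \<bar>y\<bar>)\<close>. The drop in \<open>(x, 0)\<close> is then exactly \<open>1\<close>
  if and only if \<open>a\<^bsub>x+1\<^esub> + a\<^bsub>x-1\<^esub> - 2 a\<^sub>x - 2 a\<^sub>x / m = -2 (m + 1)\<close>.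
  Away from \<open>x = 0\<close> this is solved by \<open>a\<^sub>x = m (m + 2)\<close>. In the origin, where \<open>m\<close> has a kink, the drop
  is \<open>N + 2\<close>, which is still at least \<open>1\<close>, so this choice gives the upper bound \<open>N (N + 2)\<close>. For the
  lower bound take \<open>a\<^sub>x = c m\<^sup>2\<close> with \<open>0 < c \<le> 1\<close>. On the rest of the spine the drop is then at most \<open>0\<close>,
  and in the origin it is \<open>(3 c - 1) N / 2 + (1 - c) / 2\<close>. So \<open>c = 1 / 3\<close> is the largest constant that
  keeps the drop at most \<open>1\<close> for every \<open>N\<close>, and it gives the lower bound \<open>N\<^sup>2 / 3\<close>.

  Both bounds are of order \<open>n\<^sup>2\<close>, and a function of \<open>n\<close> has the order of at most one power of \<open>n\<close>.
\<close>

section \<open>Exit times and potentials of a simple random walk\<close>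

definition neighbour_mean :: "('v \<Rightarrow> 'v \<Rightarrow> bool) \<Rightarrow> ('v \<Rightarrow> real) \<Rightarrow> 'v \<Rightarrow> real" where
  "neighbour_mean adj u w = (\<Sum>v | adj w v. u v) / card {v. adj w v}"

lemma exit_time_gt_iff: "enat k < exit_time S B \<omega> \<longleftrightarrow> (\<forall>i\<le>k. S i \<omega> \<in> B)"
proof -
  have "enat k < exit_time S B \<omega> \<longleftrightarrow> enat (Suc k) \<le> exit_time S B \<omega>"
    by (simp add: Suc_ile_eq)
  also have "\<dots> \<longleftrightarrow> (\<forall>i. S i \<omega> \<notin> B \<longrightarrow> Suc k \<le> i)"
    by (auto simp: exit_time_def le_Inf_iff)
  also have "\<dots> \<longleftrightarrow> (\<forall>i\<le>k. S i \<omega> \<in> B)"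
    by (metis not_less_eq_eq)
  finally show ?thesis .
qed

context simple_random_walk
begin

declare measurable_walk [measurable]

lemma pred_walk_in [measurable]: "Measurable.pred M (\<lambda>\<omega>. S i \<omega> \<in> B)"
  by (rule pred_sets2[OF _ measurable_walk]) simp

text \<open>
  Only the times before \<open>k\<close> are restricted, so \<open>v\<close> may lie outside \<open>B\<close>: the potentials are evaluated
  in the exit point as well.
\<close>

definition stopped_law :: "'v set \<Rightarrow> nat \<Rightarrow> 'v \<Rightarrow> real" where
  "stopped_law B k v = \<P>(\<omega> in M. S k \<omega> = v \<and> (\<forall>i<k. S i \<omega> \<in> B))"

definition survival :: "'v set \<Rightarrow> nat \<Rightarrow> real" where
  "survival B k = \<P>(\<omega> in M. \<forall>i\<le>k. S i \<omega> \<in> B)"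

lemma stopped_law_nonneg: "0 \<le> stopped_law B k v"
  by (simp add: stopped_law_def)

lemma survival_nonneg: "0 \<le> survival B k"
  by (simp add: survival_def)

lemma mean_exit_time_eq_suminf_survival:
  "mean_exit_time M S B = (\<Sum>k. ennreal (survival B k))"
proof -
  have [measurable]: "exit_time S B \<in> measurable M (count_space UNIV)"
  proof -
    have "exit_time S B = (\<lambda>\<omega>. INF i. if S i \<omega> \<in> B then \<infinity> else enat i)"
      by (rule ext) (auto simp: exit_time_def intro!: antisym Inf_greatest INF_greatest intro: Inf_lower INF_lower2)
    then show ?thesis by (simp only:) measurable
  qed
  show ?thesis
    unfolding mean_exit_time_def survival_def
    by (subst nn_integral_enat_function) (simp_all add: exit_time_gt_iff emeasure_eq_measure)
qed

text \<open>
  For a path of probability \<open>0\<close> both sides vanish, so the step rule can be summed over all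
  paths without watching the condition of the conditional probability.
\<close>

lemma prob_step:
  "\<P>(\<omega> in M. S (Suc k) \<omega> = v \<and> (\<forall>i\<le>k. S i \<omega> = s i)) =
    \<P>(\<omega> in M. \<forall>i\<le>k. S i \<omega> = s i) * pmf (pmf_of_set {w. adj (s k) w}) v"
proof (cases "\<P>(\<omega> in M. \<forall>i\<le>k. S i \<omega> = s i) = 0")
  case True
  have "\<P>(\<omega> in M. S (Suc k) \<omega> = v \<and> (\<forall>i\<le>k. S i \<omega> = s i)) \<le> \<P>(\<omega> in M. \<forall>i\<le>k. S i \<omega> = s i)"
    by (rule finite_measure_mono) auto
  with True show ?thesis
    by (simp add: measure_le_0_iff)
next
  case False
  then have pos: "\<P>(\<omega> in M. \<forall>i\<le>k. S i \<omega> = s i) > 0"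
    by (simp add: zero_less_measure_iff)
  from walk_step[OF pos, of v] False show ?thesis
    by (simp add: cond_prob_def field_simps)
qed

text \<open>
  The law of the walk is known only conditionally on whole trajectories. Inside a finite set there
  are finitely many trajectories of a given length, so events can be split along them.
\<close>

lemma prob_eq_sum_paths:
  assumes "finite B" and [measurable]: "Measurable.pred M Q"
  shows "\<P>(\<omega> in M. Q \<omega> \<and> (\<forall>i\<le>k. S i \<omega> \<in> B)) =
    (\<Sum>s\<in>{..k} \<rightarrow>\<^sub>E B. \<P>(\<omega> in M. Q \<omega> \<and> (\<forall>i\<le>k. S i \<omega> = s i)))"
proof (rule prob_sum)
  show "finite ({..k} \<rightarrow>\<^sub>E B)"
    using \<open>finite B\<close> by (intro finite_PiE) auto
  show "AE \<omega> in M. (\<forall>s\<in>{..k} \<rightarrow>\<^sub>E B. Q \<omega> \<and> (\<forall>i\<le>k. S i \<omega> = s i) \<longrightarrow> Q \<omega> \<and> (\<forall>i\<le>k. S i \<omega> \<in> B)) \<and>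
      (Q \<omega> \<and> (\<forall>i\<le>k. S i \<omega> \<in> B) \<longrightarrow> (\<exists>!s\<in>{..k} \<rightarrow>\<^sub>E B. Q \<omega> \<and> (\<forall>i\<le>k. S i \<omega> = s i)))"
  proof (intro AE_I2 conjI ballI impI)
    fix \<omega>
    assume stays: "Q \<omega> \<and> (\<forall>i\<le>k. S i \<omega> \<in> B)"
    let ?s = "restrict (\<lambda>i. S i \<omega>) {..k}"
    \<comment> \<open>Uniqueness needs the extensional function space: beyond \<open>k\<close> all members agree.\<close>
    show "\<exists>!s\<in>{..k} \<rightarrow>\<^sub>E B. Q \<omega> \<and> (\<forall>i\<le>k. S i \<omega> = s i)"
    proof (rule ex1I[where a = ?s])
      show "?s \<in> {..k} \<rightarrow>\<^sub>E B \<and> Q \<omega> \<and> (\<forall>i\<le>k. S i \<omega> = ?s i)"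
        using stays by auto
      show "s = ?s" if "s \<in> {..k} \<rightarrow>\<^sub>E B \<and> Q \<omega> \<and> (\<forall>i\<le>k. S i \<omega> = s i)" for s
        using that by (intro extensionalityI[where A = "{..k}"]) (auto simp: PiE_def)
    qed
  qed (metis PiE_mem atMost_iff)+
  show "{\<omega> \<in> space M. Q \<omega> \<and> (\<forall>i\<le>k. S i \<omega> = s i)} \<in> events" for s
    by measurable
  show "{\<omega> \<in> space M. Q \<omega> \<and> (\<forall>i\<le>k. S i \<omega> \<in> B)} \<in> events"
    by measurable
qed

lemma stopped_law_inside:
  assumes "w \<in> B"
  shows "stopped_law B k w = \<P>(\<omega> in M. S k \<omega> = w \<and> (\<forall>i\<le>k. S i \<omega> \<in> B))"
  unfolding stopped_law_def using assms
  by (intro arg_cong[where f = prob]) (auto simp: le_less)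

lemma survival_eq_sum_stopped_law:
  assumes "finite B"
  shows "survival B k = (\<Sum>w\<in>B. stopped_law B k w)"
proof -
  have "survival B k = (\<Sum>w\<in>B. \<P>(\<omega> in M. S k \<omega> = w \<and> (\<forall>i\<le>k. S i \<omega> \<in> B)))"
    unfolding survival_def using assms by (intro prob_sum) auto
  then show ?thesis
    by (simp add: stopped_law_inside)
qed

lemma stopped_law_le_survival: "finite B \<Longrightarrow> w \<in> B \<Longrightarrow> stopped_law B k w \<le> survival B k"
  unfolding survival_eq_sum_stopped_law
  by (rule member_le_sum) (auto simp: stopped_law_nonneg)

text \<open>
  This recursion is the Markov property of the stopped walk: after grouping the trajectories by their
  last point, only that point matters for the next step. From here on the walk enters only through
  deterministic sums.
\<close>

lemma stopped_law_Suc: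
  assumes "finite B"
  shows "stopped_law B (Suc k) v = (\<Sum>w\<in>B. stopped_law B k w * pmf (pmf_of_set {v. adj w v}) v)"
proof -
  define paths where "paths = {..k} \<rightarrow>\<^sub>E B"
  define p where "p s = \<P>(\<omega> in M. \<forall>i\<le>k. S i \<omega> = s i)" for s
  let ?q = "\<lambda>w. pmf (pmf_of_set {v. adj w v}) v"
  have law: "stopped_law B k w = (\<Sum>s\<in>paths. if s k = w then p s else 0)" if "w \<in> B" for w
  proof -
    have "\<P>(\<omega> in M. S k \<omega> = w \<and> (\<forall>i\<le>k. S i \<omega> = s i)) = (if s k = w then p s else 0)" for s
    proof (cases "s k = w")
      case False
      then have "{\<omega> \<in> space M. S k \<omega> = w \<and> (\<forall>i\<le>k. S i \<omega> = s i)} = {}"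
        by auto
      with False show ?thesis
        by (simp only: measure_empty if_False)
    qed (auto simp: p_def intro!: arg_cong[where f = prob])
    then show ?thesis
      unfolding stopped_law_inside[OF that] paths_def by (subst prob_eq_sum_paths) (auto simp: assms)
  qed
  have "stopped_law B (Suc k) v = (\<Sum>s\<in>paths. p s * ?q (s k))"
    unfolding stopped_law_def paths_def p_def prob_step[symmetric] less_Suc_eq_le
    by (rule prob_eq_sum_paths) (simp_all add: assms)
  also have "\<dots> = (\<Sum>s\<in>paths. \<Sum>w\<in>B. if s k = w then p s * ?q w else 0)"
    using assms by (intro sum.cong refl) (auto simp: paths_def PiE_mem)
  also have "\<dots> = (\<Sum>w\<in>B. (\<Sum>s\<in>paths. if s k = w then p s else 0) * ?q w)"
    by (subst sum.swap) (auto simp: sum_distrib_right intro!: sum.cong)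
  finally show ?thesis
    by (simp add: law)
qed

lemma stopped_law_0: "stopped_law B 0 v = (if v = start then 1 else 0)"
proof -
  have "AE \<omega> in M. (S 0 \<omega> = v) = (v = start)"
    using walk_start by eventually_elim auto
  then have "\<P>(\<omega> in M. S 0 \<omega> = v) = \<P>(\<omega> in M. v = start)"
    by (intro finite_measure_eq_AE) auto
  then show ?thesis
    by (simp add: stopped_law_def prob_space)
qed

text \<open>
  The set \<open>V\<close> stands for a finite set that contains \<open>start\<close>, \<open>B\<close> and its neighbours, hence almost
  surely the position at time \<open>k\<close> if \<open>B\<close> has not been left before. It makes the mean a finite sum.
\<close>

definition stopped_mean :: "'v set \<Rightarrow> 'v set \<Rightarrow> ('v \<Rightarrow> real) \<Rightarrow> nat \<Rightarrow> real" where
  "stopped_mean V B u k = (\<Sum>v\<in>V. stopped_law B k v * u v)"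

lemma stopped_mean_0: "finite V \<Longrightarrow> start \<in> V \<Longrightarrow> stopped_mean V B u 0 = u start"
  by (simp add: stopped_mean_def stopped_law_0 if_distrib[where f = "\<lambda>c. c * _"] cong: if_cong)

lemma stopped_mean_Suc:
  assumes V: "finite V" "B \<subseteq> V"
    and nbs: "\<And>w. w \<in> B \<Longrightarrow> {v. adj w v} \<noteq> {} \<and> {v. adj w v} \<subseteq> V"
  shows "stopped_mean V B u (Suc k) = (\<Sum>w\<in>B. stopped_law B k w * neighbour_mean adj u w)"
proof -
  have B: "finite B"
    using V finite_subset by blast
  have mean: "(\<Sum>v\<in>V. pmf (pmf_of_set {v. adj w v}) v * u v) = neighbour_mean adj u w" if "w \<in> B" for w
  proof -
    have fin: "finite {v. adj w v}"
      using nbs[OF that] V finite_subset by blast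
    have "(\<Sum>v\<in>V. pmf (pmf_of_set {v. adj w v}) v * u v) = (LINT v|measure_pmf (pmf_of_set {v. adj w v}). u v)"
      using nbs[OF that] V fin
      by (subst integral_measure_pmf[where A = V]) auto
    then show ?thesis
      using nbs[OF that] fin by (simp add: integral_pmf_of_set neighbour_mean_def)
  qed
  have "stopped_mean V B u (Suc k) =
      (\<Sum>w\<in>B. \<Sum>v\<in>V. stopped_law B k w * (pmf (pmf_of_set {v. adj w v}) v * u v))"
    unfolding stopped_mean_def stopped_law_Suc[OF B] sum_distrib_right
    by (subst sum.swap) (simp add: mult.assoc)
  also have "\<dots> = (\<Sum>w\<in>B. stopped_law B k w * neighbour_mean adj u w)"
    by (simp add: sum_distrib_left[symmetric] mean)
  finally show ?thesis .
qed

text \<open>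
  In step \<open>k\<close> the stopped mean of \<open>g\<close> drops by at least the mass \<open>survival B k\<close> that is still
  moving, and it drops further when mass sitting outside \<open>B\<close> is discarded, since \<open>g \<ge> 0\<close>. The total drop
  is at most \<open>g start\<close>, and the survival probabilities add up to the mean exit time.
\<close>

theorem mean_exit_time_le:
  assumes V: "finite V" "B \<subseteq> V" "start \<in> V"
    and nbs: "\<And>w. w \<in> B \<Longrightarrow> {v. adj w v} \<noteq> {} \<and> {v. adj w v} \<subseteq> V"
    and nonneg: "\<And>v. v \<in> V \<Longrightarrow> 0 \<le> g v"
    and super: "\<And>w. w \<in> B \<Longrightarrow> neighbour_mean adj g w \<le> g w - 1"
  shows "mean_exit_time M S B \<le> ennreal (g start)"
proof -
  have B: "finite B"
    using V finite_subset by blast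
  have Suc_eq: "stopped_mean V B g (Suc k) = (\<Sum>w\<in>B. stopped_law B k w * neighbour_mean adj g w)" for k
    using V nbs by (intro stopped_mean_Suc) auto
  have step: "stopped_mean V B g (Suc k) \<le> stopped_mean V B g k - survival B k" for k
  proof -
    have "stopped_mean V B g (Suc k) \<le> (\<Sum>w\<in>B. stopped_law B k w * (g w - 1))"
      unfolding Suc_eq
      by (intro sum_mono mult_left_mono super stopped_law_nonneg)
    also have "\<dots> = (\<Sum>w\<in>B. stopped_law B k w * g w) - survival B k"
      by (simp add: survival_eq_sum_stopped_law[OF B] right_diff_distrib sum_subtractf)
    also have "(\<Sum>w\<in>B. stopped_law B k w * g w) \<le> stopped_mean V B g k"
      unfolding stopped_mean_def using V nonneg
      by (intro sum_mono2) (auto intro: mult_nonneg_nonneg stopped_law_nonneg)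
    finally show ?thesis by simp
  qed
  have tele: "sum (survival B) {..<k} + stopped_mean V B g k \<le> g start" for k
  proof (induction k)
    case 0
    show ?case using V by (simp add: stopped_mean_0)
  next
    case (Suc k)
    then show ?case using step[of k] by simp
  qed
  have "0 \<le> stopped_mean V B g k" for k
    unfolding stopped_mean_def by (intro sum_nonneg mult_nonneg_nonneg nonneg stopped_law_nonneg)
  then have "sum (survival B) {..<k} \<le> g start" for k
    using tele[of k] by (smt (verit))
  then have "(\<Sum>i<k. ennreal (survival B i)) \<le> ennreal (g start)" for k
    by (simp add: sum_ennreal survival_nonneg ennreal_leI)
  then show ?thesis
    unfolding mean_exit_time_eq_suminf_survival by (intro suminf_le_const) auto
qed

text \<open>
  The same telescoping sum with reversed inequalities leaves the stopped mean of \<open>h\<close> at time \<open>k\<close> as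
  an error. It is at most a constant times \<open>survival B k\<close>, because \<open>h \<le> 0\<close> outside the finite
  set \<open>B\<close>. If the mean exit time is finite, then the survival probabilities are summable and the
  error tends to \<open>0\<close>.
\<close>

theorem mean_exit_time_ge:
  assumes V: "finite V" "B \<subseteq> V" "start \<in> V"
    and nbs: "\<And>w. w \<in> B \<Longrightarrow> {v. adj w v} \<noteq> {} \<and> {v. adj w v} \<subseteq> V"
    and outside: "\<And>v. v \<in> V - B \<Longrightarrow> h v \<le> 0"
    and sub: "\<And>w. w \<in> B \<Longrightarrow> h w - 1 \<le> neighbour_mean adj h w"
  shows "ennreal (h start) \<le> mean_exit_time M S B"
proof (cases "mean_exit_time M S B = \<top>")
  case False
  have B: "finite B"
    using V finite_subset by blast
  have summable: "summable (survival B)"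
    using False survival_nonneg unfolding mean_exit_time_eq_suminf_survival
    by (intro summable_suminf_not_top) auto
  have inside: "stopped_mean V B h k \<le> (\<Sum>w\<in>B. stopped_law B k w * h w)" for k
  proof -
    have "stopped_mean V B h k = (\<Sum>w\<in>B. stopped_law B k w * h w) + (\<Sum>w\<in>V - B. stopped_law B k w * h w)"
      unfolding stopped_mean_def using V by (simp add: sum.subset_diff[of B V])
    moreover have "(\<Sum>w\<in>V - B. stopped_law B k w * h w) \<le> 0"
      by (intro sum_nonpos mult_nonneg_nonpos outside stopped_law_nonneg)
    ultimately show ?thesis by simp
  qed
  have Suc_eq: "stopped_mean V B h (Suc k) = (\<Sum>w\<in>B. stopped_law B k w * neighbour_mean adj h w)" for k
    using V nbs by (intro stopped_mean_Suc) auto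
  have step: "stopped_mean V B h k - survival B k \<le> stopped_mean V B h (Suc k)" for k
  proof -
    have "stopped_mean V B h k - survival B k \<le> (\<Sum>w\<in>B. stopped_law B k w * (h w - 1))"
      using inside[of k] by (simp add: survival_eq_sum_stopped_law[OF B] right_diff_distrib sum_subtractf)
    also have "\<dots> \<le> stopped_mean V B h (Suc k)"
      unfolding Suc_eq
      by (intro sum_mono mult_left_mono sub stopped_law_nonneg)
    finally show ?thesis .
  qed
  have tele: "h start \<le> sum (survival B) {..<k} + stopped_mean V B h k" for k
  proof (induction k)
    case 0
    show ?case using V by (simp add: stopped_mean_0)
  next
    case (Suc k)
    then show ?case using step[of k] by simp
  qed
  have bound: "stopped_mean V B h k \<le> survival B k * (\<Sum>w\<in>B. \<bar>h w\<bar>)" for k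
  proof -
    have "(\<Sum>w\<in>B. stopped_law B k w * h w) \<le> (\<Sum>w\<in>B. survival B k * \<bar>h w\<bar>)"
    proof (rule sum_mono)
      fix w assume "w \<in> B"
      have "stopped_law B k w * h w \<le> stopped_law B k w * \<bar>h w\<bar>"
        by (intro mult_left_mono stopped_law_nonneg) simp
      also have "\<dots> \<le> survival B k * \<bar>h w\<bar>"
        using B \<open>w \<in> B\<close> by (intro mult_right_mono stopped_law_le_survival) auto
      finally show "stopped_law B k w * h w \<le> survival B k * \<bar>h w\<bar>" .
    qed
    then show ?thesis
      using inside[of k] by (simp add: sum_distrib_left)
  qed
  have "h start \<le> sum (survival B) {..<k} + survival B k * (\<Sum>w\<in>B. \<bar>h w\<bar>)" for k
    using tele[of k] bound[of k] by simp
  moreover have "(\<lambda>k. sum (survival B) {..<k} + survival B k * (\<Sum>w\<in>B. \<bar>h w\<bar>))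
      \<longlonglongrightarrow> suminf (survival B) + 0 * (\<Sum>w\<in>B. \<bar>h w\<bar>)"
    by (intro tendsto_intros summable_LIMSEQ summable_LIMSEQ_zero summable)
  ultimately have "h start \<le> suminf (survival B) + 0 * (\<Sum>w\<in>B. \<bar>h w\<bar>)"
    by (intro LIMSEQ_le_const) auto
  then show ?thesis
    unfolding mean_exit_time_eq_suminf_survival
    by (subst suminf_ennreal2) (auto simp: summable survival_nonneg intro: ennreal_leI)
qed simp

end

section \<open>Potentials on the comb\<close>

lemma neighbour_mean_comb:
  "neighbour_mean comb_adj u (x, y) =
    (if y = 0 then (u (x, 1) + u (x, -1) + u (x + 1, 0) + u (x - 1, 0)) / 4
     else (u (x, y + 1) + u (x, y - 1)) / 2)"
  by (simp add: neighbour_mean_def comb_neighbours)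

lemma comb_neighbours_ball:
  assumes "w \<in> comb_ball n"
  shows "{v. comb_adj w v} \<noteq> {} \<and> {v. comb_adj w v} \<subseteq> comb_ball (Suc n)"
  using assms by (cases w) (auto simp: comb_neighbours comb_ball_def)

lemma finite_comb_ball: "finite (comb_ball n)"
proof (rule finite_subset)
  show "comb_ball n \<subseteq> {- int n..int n} \<times> {- int n..int n}"
    by (auto simp: comb_ball_def)
qed simp

text \<open>
  These are the functions \<open>(m - \<bar>y\<bar>) (a\<^sub>x / m + \<bar>y\<bar>)\<close> with \<open>m = N - \<bar>x\<bar>\<close>, for \<open>a\<^sub>x = m (m + 2)\<close> and
  \<open>a\<^sub>x = m\<^sup>2 / 3\<close>, with the division by \<open>m\<close> carried out.
\<close>

definition comb_super :: "real \<Rightarrow> int \<times> int \<Rightarrow> real" where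
  "comb_super N = (\<lambda>(x, y). (N - \<bar>x\<bar> - \<bar>y\<bar>) * (N - \<bar>x\<bar> + 2 + \<bar>y\<bar>))"

definition comb_sub :: "real \<Rightarrow> int \<times> int \<Rightarrow> real" where
  "comb_sub N = (\<lambda>(x, y). (N - \<bar>x\<bar> - \<bar>y\<bar>) * ((N - \<bar>x\<bar>) / 3 + \<bar>y\<bar>))"

text \<open>
  A coordinate cannot change from positive to negative in one step. So the signs of the coordinates of
  \<open>w\<close> resolve all absolute values in \<open>w\<close> and its neighbours, and a polynomial inequality remains.
\<close>

lemma comb_super_drift:
  assumes "w \<in> comb_ball n"
  shows "neighbour_mean comb_adj (comb_super (real (Suc n))) w \<le> comb_super (real (Suc n)) w - 1"
proof -
  obtain x y where w: "w = (x, y)" by (cases w)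
  consider (tooth) "y > 0" | (tooth') "y < 0" | (spine) "y = 0" "x > 0" | (spine') "y = 0" "x < 0"
    | (origin) "y = 0" "x = 0" by linarith
  then show ?thesis
    by cases (simp_all add: w neighbour_mean_comb comb_super_def abs_of_nonneg abs_of_nonpos field_simps del: of_int_abs)
qed

lemma comb_sub_drift:
  assumes "w \<in> comb_ball n"
  shows "comb_sub (real (Suc n)) w - 1 \<le> neighbour_mean comb_adj (comb_sub (real (Suc n))) w"
proof -
  obtain x y where w: "w = (x, y)" by (cases w)
  consider (tooth) "y > 0" | (tooth') "y < 0" | (spine) "y = 0" "x > 0" | (spine') "y = 0" "x < 0"
    | (origin) "y = 0" "x = 0" by linarith
  moreover have "real_of_int (\<bar>x\<bar> + \<bar>y\<bar>) \<le> real n"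
    using assms unfolding w comb_ball_def by simp
  ultimately show ?thesis
    by cases (simp_all add: w neighbour_mean_comb comb_sub_def abs_of_nonneg abs_of_nonpos field_simps del: of_int_abs)
qed

lemma mean_exit_time_comb_ball:
  assumes "simple_random_walk M comb_adj (0, 0) S"
  shows "ennreal ((real n + 1)\<^sup>2 / 3) \<le> mean_exit_time M S (comb_ball n)"
    and "mean_exit_time M S (comb_ball n) \<le> ennreal ((real n + 1) * (real n + 3))"
proof -
  interpret simple_random_walk M comb_adj "(0, 0)" S by fact
  have V: "finite (comb_ball (Suc n))" "comb_ball n \<subseteq> comb_ball (Suc n)" "(0, 0) \<in> comb_ball (Suc n)"
    by (simp_all add: finite_comb_ball) (auto simp: comb_ball_def)
  have "comb_sub (real (Suc n)) v \<le> 0" if "v \<in> comb_ball (Suc n) - comb_ball n" for v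
  proof -
    obtain x y where v: "v = (x, y)" by (cases v)
    have "\<bar>x\<bar> + \<bar>y\<bar> = int (Suc n)" using that by (auto simp: v comb_ball_def)
    then have "\<bar>real_of_int x\<bar> + \<bar>real_of_int y\<bar> = real (Suc n)" by linarith
    then have "real (Suc n) - \<bar>real_of_int x\<bar> - \<bar>real_of_int y\<bar> = 0" by linarith
    then show ?thesis by (simp add: v comb_sub_def del: of_nat_Suc)
  qed
  from mean_exit_time_ge[OF V comb_neighbours_ball this comb_sub_drift]
  show "ennreal ((real n + 1)\<^sup>2 / 3) \<le> mean_exit_time M S (comb_ball n)"
    by (simp add: comb_sub_def power2_eq_square add.commute)
  have "0 \<le> comb_super (real (Suc n)) v" if "v \<in> comb_ball (Suc n)" for v
  proof -
    obtain x y where v: "v = (x, y)" by (cases v)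
    have "\<bar>x\<bar> + \<bar>y\<bar> \<le> int (Suc n)" using that by (auto simp: v comb_ball_def)
    then have "\<bar>real_of_int x\<bar> + \<bar>real_of_int y\<bar> \<le> real (Suc n)" by linarith
    then show ?thesis by (auto simp: v comb_super_def intro!: mult_nonneg_nonneg)
  qed
  from mean_exit_time_le[OF V comb_neighbours_ball this comb_super_drift]
  show "mean_exit_time M S (comb_ball n) \<le> ennreal ((real n + 1) * (real n + 3))"
    by (simp add: comb_super_def add.commute add.assoc)
qed

section \<open>The walk dimension\<close>

lemma powr_eventually_le_imp_le:
  fixes c C :: real
  assumes "0 < c" and "\<forall>\<^sub>F n in sequentially. c * real n powr a \<le> C * real n powr b"
  shows "a \<le> b"
proof (rule ccontr)
  assume "\<not> a \<le> b"
  then have "(\<lambda>n. C * real n powr (b - a)) \<longlonglongrightarrow> C * 0"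
    by (intro tendsto_mult tendsto_const tendsto_neg_powr filterlim_real_sequentially) simp
  then have "\<forall>\<^sub>F n in sequentially. C * real n powr (b - a) < c"
    using \<open>0 < c\<close> by (intro order_tendstoD(2)) auto
  with assms(2) eventually_gt_at_top[of 0] have "\<forall>\<^sub>F n::nat in sequentially. False"
  proof eventually_elim
    case (elim n)
    have "real n powr b = real n powr (b - a) * real n powr a"
      by (simp add: powr_add[symmetric])
    with elim(1) have "c * real n powr a \<le> (C * real n powr (b - a)) * real n powr a"
      by simp
    with elim show False
      by simp
  qed
  then show False by simp
qed

lemma has_walk_dimension_unique:
  assumes "has_walk_dimension M S B \<alpha>" "has_walk_dimension M S B \<beta>"
  shows "\<alpha> = \<beta>"
proof -
  have "\<alpha> \<le> \<beta>" if a: "has_walk_dimension M S B \<alpha>" and b: "has_walk_dimension M S B \<beta>" for \<alpha> \<beta>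
  proof -
    obtain c where c: "0 < c"
      and lower: "\<forall>\<^sub>F n in sequentially. ennreal (c * real n powr \<alpha>) \<le> mean_exit_time M S (B n)"
      using a unfolding has_walk_dimension_def eventually_conj_iff by blast
    obtain C where C: "0 < C"
      and upper: "\<forall>\<^sub>F n in sequentially. mean_exit_time M S (B n) \<le> ennreal (C * real n powr \<beta>)"
      using b unfolding has_walk_dimension_def eventually_conj_iff by blast
    from lower upper have "\<forall>\<^sub>F n in sequentially. c * real n powr \<alpha> \<le> C * real n powr \<beta>"
    proof eventually_elim
      case (elim n)
      then have "ennreal (c * real n powr \<alpha>) \<le> ennreal (C * real n powr \<beta>)" by (rule order_trans)
      then show ?case using C by (simp add: ennreal_le_iff)
    qed
    with c show ?thesis by (rule powr_eventually_le_imp_le)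
  qed
  with assms show ?thesis by (auto intro: antisym)
qed

theorem corollary4p14:
  fixes M :: "'w measure" and S :: "nat \<Rightarrow> 'w \<Rightarrow> int \<times> int" and \<alpha> :: real
  assumes "simple_random_walk M comb_adj (0, 0) S"
  shows "has_walk_dimension M S comb_ball \<alpha> \<longleftrightarrow> \<alpha> = 2"
proof -
  have "has_walk_dimension M S comb_ball 2"
    unfolding has_walk_dimension_def
  proof (intro exI conjI)
    show "\<forall>\<^sub>F n in sequentially. ennreal (1 / 3 * real n powr 2) \<le> mean_exit_time M S (comb_ball n) \<and>
        mean_exit_time M S (comb_ball n) \<le> ennreal (8 * real n powr 2)"
      using eventually_gt_at_top[of 0]
    proof eventually_elim
      case (elim n)
      then have n: "1 \<le> real n" by simp
      have "ennreal (1 / 3 * real n powr 2) \<le> ennreal ((real n + 1)\<^sup>2 / 3)"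
        using n by (intro ennreal_leI) (simp add: power2_eq_square algebra_simps)
      moreover have "(real n + 1) * (real n + 3) \<le> 8 * real n powr 2"
      proof -
        have "real n \<le> real n * real n"
          using mult_right_mono[OF n, of "real n"] by simp
        moreover have "(real n + 1) * (real n + 3) = real n * real n + 4 * real n + 3"
          by (simp add: algebra_simps)
        moreover have "real n powr 2 = real n * real n"
          by (simp add: power2_eq_square)
        ultimately show ?thesis
          using n by linarith
      qed
      then have "ennreal ((real n + 1) * (real n + 3)) \<le> ennreal (8 * real n powr 2)"
        by (rule ennreal_leI)
      ultimately show ?case
        using mean_exit_time_comb_ball[OF assms, of n] by (meson order_trans)
    qed
  qed simp_all
  then show ?thesis
    using has_walk_dimension_unique by blast
qed

end
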